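(* Let $F$ and $F_n$, $n=1,2,\ldots$, be distribution functions on $\mathbb{R}$. Then $\ell(F_n,F)\to 0$ as $n\to\infty$ if and only if $F_n(x)\to F(x)$ as $n\to\infty$ at every continuity point $x$ of $F$.
   Context: A distribution function is a nondecreasing right-continuous function $F:\mathbb{R}\to[0,1]$ with $F(-\infty)=0$ and $F(+\infty)=1$ (as limits). The Lévy distance between distribution functions is $$\ell(F,G)=\inf\{h>0 : F(x-h)-h\le G(x)\le F(x+h)+h \text{ for all } x\in\mathbb{R}\}.$$ *)

theory Defs
  imports Complex_Main
begin

definition distribution_function :: "(real \<Rightarrow> real) \<Rightarrow> bool" where
  "distribution_function F \<longleftrightarrow>
     mono F \<and> (\<forall>x. continuous (at_right x) F) \<and> range F \<subseteq> {0..1} \<and>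
     (F \<longlongrightarrow> 0) at_bot \<and> (F \<longlongrightarrow> 1) at_top"

(* For distribution functions the set below contains h = 1 and is bounded below by 0,
   so its real Inf is a genuine infimum. *)
definition levy_dist :: "(real \<Rightarrow> real) \<Rightarrow> (real \<Rightarrow> real) \<Rightarrow> real" where
  "levy_dist F G = Inf {h. h > 0 \<and> (\<forall>x. F (x - h) - h \<le> G x \<and> G x \<le> F (x + h) + h)}"

end

theory Submission
  imports Defs "HOL-Analysis.Analysis"
begin

text \<open>If the Levy distance is below \<open>h\<close>, the band inequality of width \<open>h\<close> sandwiches
\<open>F\<^sub>n x\<close> between \<open>F (x - h) - h\<close> and \<open>F (x + h) + h\<close>, and continuity of \<open>F\<close> at \<open>x\<close> closes the gap.
Conversely, the continuity points of a monotone function are dense, so by compactness finitely many of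
them meet every interval \<open>(y, y + \<epsilon>)\<close> with \<open>y\<close> in a large bounded interval. Closeness of \<open>F\<^sub>n\<close> to \<open>F\<close> at
these points, together with monotonicity and the smallness of both tails, gives the band inequality of
width \<open>\<epsilon>\<close> everywhere.\<close>

lemma distribution_function_mono: "distribution_function F \<Longrightarrow> mono F"
  by (simp add: distribution_function_def)

lemma distribution_function_bounds:
  assumes "distribution_function F"
  shows "0 \<le> F x" "F x \<le> 1"
  using assms unfolding distribution_function_def by (auto simp: subset_iff)

definition levy_band :: "(real \<Rightarrow> real) \<Rightarrow> (real \<Rightarrow> real) \<Rightarrow> real \<Rightarrow> bool" where
  "levy_band F G h \<longleftrightarrow> (\<forall>x. F (x - h) - h \<le> G x \<and> G x \<le> F (x + h) + h)"

lemma levy_dist_eq: "levy_dist F G = Inf {h. h > 0 \<and> levy_band F G h}"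
  by (simp add: levy_dist_def levy_band_def)

text \<open>Widening moves both bounds outward, since \<open>F\<close> is monotone. Admissible
  widths are therefore closed upwards.\<close>

lemma levy_band_mono:
  assumes "mono F" "levy_band F G h" "h \<le> k"
  shows "levy_band F G k"
  unfolding levy_band_def
proof
  fix x
  have "F (x - k) \<le> F (x - h)" "F (x + h) \<le> F (x + k)"
    by (rule monoD[OF assms(1)], use assms(3) in simp)+
  moreover have "F (x - h) - h \<le> G x" "G x \<le> F (x + h) + h"
    using assms(2) unfolding levy_band_def by blast+
  ultimately show "F (x - k) - k \<le> G x \<and> G x \<le> F (x + k) + k"
    using assms(3) by linarith
qed

lemma levy_band_one:
  assumes "distribution_function F" "distribution_function G"
  shows "levy_band F G 1"
  unfolding levy_band_def
proof
  fix x
  show "F (x - 1) - 1 \<le> G x \<and> G x \<le> F (x + 1) + 1"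
    using distribution_function_bounds[OF assms(1), of "x - 1"]
      distribution_function_bounds[OF assms(1), of "x + 1"]
      distribution_function_bounds[OF assms(2), of x] by linarith
qed

text \<open>Needed because the real \<open>Inf\<close> is meaningful only on nonempty sets bounded
  below.\<close>

lemma levy_band_set_nonempty:
  assumes "distribution_function F" "distribution_function G"
  shows "{h. h > 0 \<and> levy_band F G h} \<noteq> {}"
proof -
  have "1 \<in> {h. h > 0 \<and> levy_band F G h}" using levy_band_one[OF assms] by simp
  then show ?thesis by blast
qed

lemma levy_dist_nonneg:
  assumes "distribution_function F" "distribution_function G"
  shows "0 \<le> levy_dist F G"
  unfolding levy_dist_eq
  by (rule cInf_greatest[OF levy_band_set_nonempty[OF assms]]) simp

lemma levy_dist_le:
  assumes "h > 0" "levy_band F G h"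
  shows "levy_dist F G \<le> h"
  unfolding levy_dist_eq using assms by (intro cInf_lower bdd_belowI[of _ 0]) auto

text \<open>No attainment of the infimum is required: some admissible \<open>k\<close> lies below
  \<open>h\<close>, and it widens to \<open>h\<close>.\<close>

lemma levy_band_if_levy_dist_less:
  assumes "distribution_function F" "distribution_function G" "levy_dist F G < h"
  shows "levy_band F G h"
proof -
  from cInf_lessD[OF levy_band_set_nonempty[OF assms(1,2)] assms(3)[unfolded levy_dist_eq]]
  obtain k where k: "levy_band F G k" "k < h" by blast
  show ?thesis
    by (rule levy_band_mono[OF distribution_function_mono[OF assms(1)] k(1) less_imp_le[OF k(2)]])
qed

text \<open>A monotone function has countably many discontinuities, too few to fill an open
  interval.\<close>

lemma mono_continuity_point_between:
  fixes F :: "real \<Rightarrow> real"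
  assumes "mono F" "a < b"
  obtains c where "a < c" "c < b" "isCont F c"
proof -
  have "\<not> {a<..<b} \<subseteq> {x. \<not> isCont F x}"
    using mono_ctble_discont[OF assms(1)] assms(2)
    by (meson countable_subset uncountable_open_interval)
  then show ?thesis using that by auto
qed

text \<open>A point \<open>c\<close> serves exactly the \<open>y\<close> in the open interval from
  \<open>c - e\<close> to \<open>c\<close>. By density of continuity points these intervals cover
  \<open>{a..b}\<close>, and compactness leaves finitely many.\<close>

lemma finite_continuity_net:
  fixes F :: "real \<Rightarrow> real"
  assumes "mono F" "e > 0"
  obtains C where "finite C" "\<And>c. c \<in> C \<Longrightarrow> isCont F c"
    "\<And>y. a \<le> y \<Longrightarrow> y \<le> b \<Longrightarrow> \<exists>c\<in>C. y < c \<and> c < y + e"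
proof -
  have "{a..b} \<subseteq> (\<Union>c\<in>{c. isCont F c}. {c - e<..<c})"
  proof
    fix y
    obtain c where "y < c" "c < y + e" "isCont F c"
      using mono_continuity_point_between[OF assms(1), of y "y + e"] assms(2) by auto
    then show "y \<in> (\<Union>c\<in>{c. isCont F c}. {c - e<..<c})" by auto
  qed
  from compactE_image[OF compact_Icc open_greaterThanLessThan this]
  obtain C where C: "C \<subseteq> {c. isCont F c}" "finite C" "{a..b} \<subseteq> (\<Union>c\<in>C. {c - e<..<c})" .
  show ?thesis
  proof (rule that[of C])
    fix y assume "a \<le> y" "y \<le> b"
    with C(3) have "y \<in> (\<Union>c\<in>C. {c - e<..<c})" by (meson atLeastAtMost_iff subsetD)
    then obtain c where "c \<in> C" "c - e < y" "y < c" by auto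
    then show "\<exists>c\<in>C. y < c \<and> c < y + e" by (intro bexI[of _ c]) auto
  qed (use C in auto)
qed

lemma levy_band_if_close_on_net:
  assumes F: "distribution_function F" and G: "distribution_function G"
    and net: "\<And>y. a \<le> y \<Longrightarrow> y \<le> b \<Longrightarrow> \<exists>c\<in>C. y < c \<and> c < y + e"
    and close: "\<And>c. c \<in> C \<Longrightarrow> \<bar>G c - F c\<bar> < e / 2"
    and tails: "F (a + e) \<le> e / 2" "1 - e / 2 \<le> F b"
    and "a \<le> b" "e > 0"
  shows "levy_band G F e"
proof -
  note F_mono = monoD[OF distribution_function_mono[OF F]]
    and G_mono = monoD[OF distribution_function_mono[OF G]]
  \<comment> \<open>Stated with \<open>y = x - e\<close>, so that both halves of the band compare
    values at \<open>y\<close> and \<open>y + e\<close>, with room for a net point \<open>c\<close>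
    in between.\<close>
  have lower: "G y - e \<le> F (y + e)" for y
  proof -
    consider "y < a" | "a \<le> y" "y \<le> b" | "b < y" by linarith
    then show ?thesis
    proof cases
      case 1
      \<comment> \<open>Smallness of the left tail passes from \<open>F\<close> to \<open>G\<close>
        through \<open>c\<close>: \<open>G y \<le> G c < F c + e / 2 \<le> e\<close>. As
        \<open>c\<close> may exceed \<open>a\<close>, the tail bound is assumed at
        \<open>a + e\<close>.\<close>
      obtain c where "c \<in> C" "a < c" "c < a + e" using net[of a] \<open>a \<le> b\<close> by auto
      then show ?thesis
        using close[of c] F_mono[of c "a + e"] G_mono[of y c] 1 tails(1)
          distribution_function_bounds[OF F, of "y + e"] by linarith
    next
      case 2
      then obtain c where "c \<in> C" "y < c" "c < y + e" using net by blast
      then show ?thesis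
        using close[of c] F_mono[of c "y + e"] G_mono[of y c] \<open>e > 0\<close> by linarith
    next
      case 3
      then show ?thesis
        using F_mono[of b "y + e"] tails(2) distribution_function_bounds[OF G, of y] \<open>e > 0\<close>
        by linarith
    qed
  qed
  have upper: "F y \<le> G (y + e) + e" for y
  proof -
    consider "y < a" | "a \<le> y" "y \<le> b" | "b < y" by linarith
    then show ?thesis
    proof cases
      case 1
      then show ?thesis
        using F_mono[of y "a + e"] tails(1) distribution_function_bounds[OF G, of "y + e"] \<open>e > 0\<close>
        by linarith
    next
      case 2
      then obtain c where "c \<in> C" "y < c" "c < y + e" using net by blast
      then show ?thesis
        using close[of c] F_mono[of y c] G_mono[of c "y + e"] \<open>e > 0\<close> by linarith
    next
      case 3
      \<comment> \<open>Here \<open>c < y + e\<close>, so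
        \<open>G (y + e) \<ge> G c > F c - e / 2 \<ge> 1 - e\<close>.\<close>
      obtain c where "c \<in> C" "b < c" "c < b + e" using net[of b] \<open>a \<le> b\<close> by auto
      then show ?thesis
        using close[of c] F_mono[of b c] G_mono[of c "y + e"] 3 tails(2)
          distribution_function_bounds[OF F, of y] by linarith
    qed
  qed
  show ?thesis
    unfolding levy_band_def
  proof
    fix x
    show "G (x - e) - e \<le> F x \<and> F x \<le> G (x + e) + e"
      using lower[of "x - e"] upper[of x] by simp
  qed
qed

lemma levy_dist_tendsto_imp_tendsto:
  assumes F: "distribution_function F"
    and Fn: "\<And>n. n \<ge> 1 \<Longrightarrow> distribution_function (Fn n)"
    and lim: "(\<lambda>n. levy_dist (Fn n) F) \<longlonglongrightarrow> 0" and cont: "isCont F x"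
  shows "(\<lambda>n. Fn n x) \<longlonglongrightarrow> F x"
proof (rule tendstoI)
  fix e :: real assume "e > 0"
  then obtain d where d: "d > 0" "\<And>y. dist y x < d \<Longrightarrow> dist (F y) (F x) < e / 2"
    using cont[unfolded continuous_at_eps_delta, rule_format, of "e / 2"] by auto
  \<comment> \<open>Half of \<open>e\<close> absorbs the oscillation of \<open>F\<close> near
    \<open>x\<close>, the other half the additive slack \<open>h\<close> of the band.\<close>
  define h where "h = min (d / 2) (e / 2)"
  have h: "h > 0" "h < d" "h \<le> e / 2" using d(1) \<open>e > 0\<close> by (auto simp: h_def)
  have "\<bar>F (x + h) - F x\<bar> < e / 2" "\<bar>F (x - h) - F x\<bar> < e / 2"
    using d(2)[of "x + h"] d(2)[of "x - h"] h by (auto simp: dist_real_def)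
  then have near: "F (x + h) < F x + e / 2" "F x - e / 2 < F (x - h)"
    by linarith+
  from order_tendstoD(2)[OF lim h(1)] show "\<forall>\<^sub>F n in sequentially. dist (Fn n x) (F x) < e"
    using eventually_ge_at_top[of 1]
  proof eventually_elim
    case (elim n)
    have "levy_band (Fn n) F h"
      using levy_band_if_levy_dist_less[OF Fn F] elim by blast
    \<comment> \<open>The band shifts the argument of \<open>Fn n\<close>; reading it at
      \<open>x + h\<close> and \<open>x - h\<close> brings that argument back to
      \<open>x\<close>.\<close>
    then have "Fn n (x + h - h) - h \<le> F (x + h)" "F (x - h) \<le> Fn n (x - h + h) + h"
      unfolding levy_band_def by blast+
    then have "Fn n x < F x + e" "F x - e < Fn n x" using near h by simp_all
    then show ?case unfolding dist_real_def by linarith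
  qed
qed

lemma tendsto_imp_levy_dist_tendsto:
  assumes F: "distribution_function F"
    and Fn: "\<And>n. n \<ge> 1 \<Longrightarrow> distribution_function (Fn n)"
    and lim: "\<And>x. isCont F x \<Longrightarrow> (\<lambda>n. Fn n x) \<longlonglongrightarrow> F x"
  shows "(\<lambda>n. levy_dist (Fn n) F) \<longlonglongrightarrow> 0"
proof (rule tendstoI)
  fix r :: real assume "r > 0"
  \<comment> \<open>A band of width \<open>e\<close> only gives
    \<open>levy_dist (Fn n) F \<le> e\<close>; halving restores strictness.\<close>
  define e where "e = r / 2"
  have e: "e > 0" "e < r" using \<open>r > 0\<close> by (auto simp: e_def)
  have bot: "(F \<longlongrightarrow> 0) at_bot" and top: "(F \<longlongrightarrow> 1) at_top"
    using F by (auto simp: distribution_function_def)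
  obtain a' where a': "F x < e / 2" if "x \<le> a'" for x
    using order_tendstoD(2)[OF bot, of "e / 2"] e by (auto simp: eventually_at_bot_linorder)
  obtain b' where b': "1 - e / 2 < F x" if "b' \<le> x" for x
    using order_tendstoD(1)[OF top, of "1 - e / 2"] e by (auto simp: eventually_at_top_linorder)
  \<comment> \<open>The shift makes \<open>a + e = a'\<close>, where the left tail is small; the
    maximum ensures \<open>a \<le> b\<close>.\<close>
  define a b where "a = a' - e" and "b = max a b'"
  obtain C where C: "finite C" "\<And>c. c \<in> C \<Longrightarrow> isCont F c"
    "\<And>y. a \<le> y \<Longrightarrow> y \<le> b \<Longrightarrow> \<exists>c\<in>C. y < c \<and> c < y + e"
    using finite_continuity_net[OF distribution_function_mono[OF F] e(1)] by metis
  \<comment> \<open>Finiteness of \<open>C\<close> makes pointwise convergence uniform on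
    it.\<close>
  have "\<forall>\<^sub>F n in sequentially. \<forall>c\<in>C. dist (Fn n c) (F c) < e / 2"
    using C(1,2) lim e by (intro eventually_ball_finite ballI tendstoD) auto
  then show "\<forall>\<^sub>F n in sequentially. dist (levy_dist (Fn n) F) 0 < r"
    using eventually_ge_at_top[of 1]
  proof eventually_elim
    case (elim n)
    have "levy_band (Fn n) F e"
    proof (rule levy_band_if_close_on_net[OF F Fn[OF elim(2)] C(3)])
      show "F (a + e) \<le> e / 2" using a'[of a'] by (simp add: a_def)
      show "1 - e / 2 \<le> F b" using b'[of b] by (simp add: b_def)
    qed (use elim e in \<open>auto simp: dist_real_def b_def\<close>)
    then show ?case
      using levy_dist_le[OF e(1), of "Fn n" F] levy_dist_nonneg[OF Fn[OF elim(2)] F] e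
      by (simp add: dist_real_def)
  qed
qed

theorem theorem1p5:
  fixes F :: "real \<Rightarrow> real" and Fn :: "nat \<Rightarrow> real \<Rightarrow> real"
  assumes "distribution_function F"
    and "\<And>n. n \<ge> 1 \<Longrightarrow> distribution_function (Fn n)"
  shows "(\<lambda>n. levy_dist (Fn n) F) \<longlonglongrightarrow> 0 \<longleftrightarrow>
    (\<forall>x. isCont F x \<longrightarrow> (\<lambda>n. Fn n x) \<longlonglongrightarrow> F x)"
proof (intro iffI allI impI)
  show "(\<lambda>n. Fn n x) \<longlonglongrightarrow> F x"
    if "(\<lambda>n. levy_dist (Fn n) F) \<longlonglongrightarrow> 0" "isCont F x" for x
    by (rule levy_dist_tendsto_imp_tendsto[OF assms that])
  show "(\<lambda>n. levy_dist (Fn n) F) \<longlonglongrightarrow> 0"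
    if "\<forall>x. isCont F x \<longrightarrow> (\<lambda>n. Fn n x) \<longlonglongrightarrow> F x"
    by (rule tendsto_imp_levy_dist_tendsto[OF assms that[rule_format]])
qed

end
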